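(* The function $Q_a[b]$ has the following properties ($\mathbb N$ is the set of positive integers, $\mathbb P$ the set of primes). (1) For all $m\in\mathbb N$ there exists $n\in\mathbb N$ with $\gcd(m,n)=1$, with $Q_{mn}[mn]=Q_{mn}[m]\times Q_{mn}[n]$. (2) For all $m,n\in\mathbb P$: $Q_{mn}[mn]=Q_{mn}[m]+Q_{mn}[n]=Q_{mn}[m]\times Q_{mn}[n]$. (3) For all $m\in\mathbb P$ and all $n\in\mathbb N$ there exists $t\in\mathbb N$ with $\gcd(t,m)=1$, with $$Q_{m^n}[m^k]=\begin{cases}1&\text{if }k\in\{0,1,\dots,n-1\}\\ n+1&\text{if }k=n\end{cases}\qquad\text{and}\qquad Q_{t\times m^n}[m^n]=n+1.$$ (4) For all $p\in\mathbb P$ (and positive integers $k$): $$Q_{pk}[p]=\begin{cases}1&\text{if }k\equiv0\pmod p\\ 2&\text{if }k\not\equiv0\pmod p.\end{cases}$$ (5) For all $a\in\mathbb N$ there exist $b\in\mathbb N$ with $b\mid a$ and $x_1,x_2,\dots,x_s\in\mathbb N$ with $SQ_a[b]=x_1+x_2+\cdots+x_s$ and $MQ_a[b]=x_1\times x_2\times\cdots\times x_s$, and $$\frac{SQ_a[b]}{MQ_a[b]}=\frac{1}{x_2\times x_3\times\cdots\times x_s}+\frac{1}{x_1\times x_3\times\cdots\times x_s}+\cdots+\frac{1}{x_1\times\cdots\times x_{s-1}}.$$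
   Context: For positive integers $a,b$: $Q_a[b]$ is the number of positive integers $x$ with $\operatorname{lcm}(x,b)=a$; $SQ_a[b]$ is the sum of these integers $x$; $MQ_a[b]$ is the product of these integers $x$.
   Formalization: In (2) the primes m and n are additionally required to be distinct; for m = n the claim fails for every prime, since Q_{m²}[m²] = 3 while Q_{m²}[m] = 1, so the sum is 2 and the product is 1. *)

theory Defs
  imports Complex_Main "HOL-Number_Theory.Number_Theory"
begin

text \<open>The positive integers are the positive elements of \<open>nat\<close>. For positive \<open>a\<close> the
  set below is finite, since all its elements divide \<open>a\<close>.\<close>

definition Qset :: "nat \<Rightarrow> nat \<Rightarrow> nat set" where
  "Qset a b = {x. x > 0 \<and> lcm x b = a}"

definition Q :: "nat \<Rightarrow> nat \<Rightarrow> nat" where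
  "Q a b = card (Qset a b)"

definition SQ :: "nat \<Rightarrow> nat \<Rightarrow> nat" where
  "SQ a b = (\<Sum>x\<in>Qset a b. x)"

definition MQ :: "nat \<Rightarrow> nat \<Rightarrow> nat" where
  "MQ a b = (\<Prod>x\<in>Qset a b. x)"

end

theory Submission
  imports Defs
begin

text \<open>If \<open>lcm x b = c * b\<close> and \<open>g = gcd x b\<close>, then \<open>x * b = g * (c * b)\<close>, so \<open>x = c * g\<close>; and
  \<open>gcd (c * g) b = g\<close> says exactly that \<open>c\<close> is coprime to \<open>b div g\<close>. The solutions \<open>x\<close> thus
  correspond to the divisors \<open>g\<close> of \<open>b\<close> whose cofactor is coprime to \<open>c\<close> (\<open>Qset_eq_image\<close>).
  Two extreme cases give every value of \<open>Q\<close> in the theorem. If \<open>b\<close> and \<open>c\<close> are coprime, then all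
  divisors of \<open>b\<close> qualify and \<open>Q (c * b) b\<close> is the number of divisors of \<open>b\<close>. If every prime factor
  of \<open>b\<close> divides \<open>c\<close>, then the cofactor has to be \<open>1\<close> and only \<open>g = b\<close> qualifies.

  The two claims about \<open>Q (m * n) (m * n)\<close> then express that the divisor-counting function is
  multiplicative, together with \<open>2 + 2 = 2 * 2\<close> for two distinct primes; the claims about
  \<open>Q (m ^ n) (m ^ k)\<close> and \<open>Q (p * k) p\<close> are the two extreme cases for prime powers. The claim about
  \<open>SQ\<close> and \<open>MQ\<close> concerns any finite family of positive numbers: dividing each term of its sum by its
  product cancels that term from the product. It applies as soon as \<open>Qset a b\<close> is nonempty, which
  holds because \<open>a\<close> itself belongs to it when \<open>b dvd a\<close>.\<close>

lemma Qset_eq_image: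
  assumes "b > 0" "c > 0"
  shows "Qset (c * b) b = (*) c ` {g. g dvd b \<and> coprime c (b div g)}"
proof (intro equalityI subsetI)
  fix x assume "x \<in> Qset (c * b) b"
  then have x: "x > 0" "lcm x b = c * b"
    by (auto simp: Qset_def)
  define g where "g = gcd x b"
  have "g > 0" using assms by (simp add: g_def)
  obtain h where h: "b = g * h" by (metis g_def gcd_dvd2 dvdE)
  have "g * (c * b) = x * b"
    using prod_gcd_lcm_nat[of x b] unfolding x(2) g_def by (rule sym)
  then have "(c * g) * b = x * b" by (simp only: ac_simps)
  then have x_eq: "x = c * g" using assms by simp
  have "g * gcd c h = gcd (g * c) (g * h)" by (rule gcd_mult_distrib_nat)
  also have "\<dots> = gcd x b" by (simp only: x_eq h mult.commute)
  finally have "g * gcd c h = g" by (simp only: g_def)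
  then have "gcd c h = 1" using \<open>g > 0\<close> by simp
  then have "coprime c h" by (simp only: coprime_iff_gcd_eq_1)
  then have "g dvd b \<and> coprime c (b div g)" using \<open>g > 0\<close> h by simp
  then show "x \<in> (*) c ` {g. g dvd b \<and> coprime c (b div g)}"
    using x_eq by blast
next
  fix x assume "x \<in> (*) c ` {g. g dvd b \<and> coprime c (b div g)}"
  then obtain g where "x = c * g" "g dvd b" "coprime c (b div g)" by blast
  moreover from \<open>g dvd b\<close> obtain h where "b = g * h" ..
  ultimately have g: "x = c * g" "b = g * h" "coprime c (b div g)" by blast+
  have "g > 0" using assms g by (cases g) auto
  then have "coprime c h" using g by simp
  have "lcm (g * c) (g * h) = g * lcm c h"
    by (simp add: lcm_mult_left)
  also have "lcm c h = c * h" using \<open>coprime c h\<close> by (simp add: lcm_coprime)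
  finally show "x \<in> Qset (c * b) b"
    using g \<open>g > 0\<close> assms by (simp add: Qset_def ac_simps)
qed

lemma Q_coprime:
  assumes "b > 0" "c > 0" "coprime c b"
  shows "Q (c * b) b = card {g. g dvd b}"
proof -
  have "coprime c (b div g)" if "g dvd b" for g
    using assms(3) that by (metis coprime_mult_right_iff dvd_mult_div_cancel)
  then have "{g. g dvd b \<and> coprime c (b div g)} = {g. g dvd b}" by blast
  moreover have "inj_on ((*) c) {g. g dvd b}" using assms by (intro inj_onI) simp
  ultimately show ?thesis
    using assms by (simp add: Q_def Qset_eq_image card_image)
qed

lemma Q_eq_1_if_prime_factors_dvd:
  assumes "b > 0" "c > 0" and rad: "\<And>q. prime q \<Longrightarrow> q dvd b \<Longrightarrow> q dvd c"
  shows "Q (c * b) b = 1"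
proof -
  have "g = b" if g: "g dvd b" "coprime c (b div g)" for g
  proof -
    obtain h where h: "b = g * h" using g by blast
    then have "coprime c h" using g assms by auto
    have "h = 1"
    proof (rule ccontr)
      assume "h \<noteq> 1"
      then obtain q where q: "prime q" "q dvd h" using prime_factor_nat by blast
      then have "q dvd c" using rad h by simp
      then show False
        using q \<open>coprime c h\<close> by (meson coprime_common_divisor not_prime_unit)
    qed
    then show ?thesis using h by simp
  qed
  then have "{g. g dvd b \<and> coprime c (b div g)} = {b}" using assms by auto
  then show ?thesis using assms by (simp add: Q_def Qset_eq_image)
qed

text \<open>A divisor of \<open>m * n\<close> always splits into a divisor of \<open>m\<close> times a divisor of \<open>n\<close>;
  coprimality makes the splitting unique, since factors from different sides share nothing.\<close>

lemma card_divisors_mult_coprime: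
  fixes m n :: nat
  assumes "coprime m n"
  shows "card {d. d dvd m * n} = card {d. d dvd m} * card {d. d dvd n}"
proof -
  let ?D = "{d. d dvd m} \<times> {d. d dvd n}"
  have "inj_on (\<lambda>(u, v). u * v) ?D"
  proof (rule inj_onI, clarify)
    fix u v u' v' assume dvd: "u dvd m" "v dvd n" "u' dvd m" "v' dvd n" and eq: "u * v = u' * v'"
    have "coprime u v'" "coprime u' v"
      using dvd assms by (blast intro: coprime_divisors)+
    then show "u = u' \<and> v = v'" using eq by (simp add: coprime_crossproduct_nat)
  qed
  moreover have "(\<lambda>(u, v). u * v) ` ?D = {d. d dvd m * n}"
    by (force dest: division_decomp intro: mult_dvd_mono)
  ultimately show ?thesis by (metis card_cartesian_product card_image)
qed

lemma card_divisors_prime_power: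
  fixes p :: nat
  assumes "prime p"
  shows "card {d. d dvd p ^ n} = n + 1"
proof -
  have "{d. d dvd p ^ n} = (\<lambda>i. p ^ i) ` {..n}"
    using divides_primepow_nat[OF assms] by auto
  moreover have "inj_on (\<lambda>i. p ^ i) {..n}"
    using assms by (auto intro!: inj_onI dest: prime_gt_1_nat)
  ultimately show ?thesis by (simp add: card_image)
qed

lemma Q_prime_power_less:
  assumes "prime p" "k < n"
  shows "Q (p ^ n) (p ^ k) = 1"
proof -
  have "Q (p ^ (n - k) * p ^ k) (p ^ k) = 1"
  proof (rule Q_eq_1_if_prime_factors_dvd)
    fix q :: nat assume "prime q" "q dvd p ^ k"
    then have "q = p" using assms by (metis prime_dvd_power primes_dvd_imp_eq)
    then show "q dvd p ^ (n - k)" using assms by (simp add: dvd_power)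
  qed (use assms in \<open>auto simp: prime_gt_0_nat\<close>)
  then show ?thesis using assms by (simp flip: power_add)
qed

lemma Q_prime_power_coprime:
  assumes "prime p" "t > 0" "coprime t p"
  shows "Q (t * p ^ n) (p ^ n) = n + 1"
  using assms by (simp add: Q_coprime card_divisors_prime_power prime_gt_0_nat)

lemma sum_div_prod_eq_sum_inverse_others:
  fixes f :: "'a \<Rightarrow> 'b :: field"
  assumes "finite I" "\<And>i. i \<in> I \<Longrightarrow> f i \<noteq> 0"
  shows "(\<Sum>i\<in>I. f i) / (\<Prod>i\<in>I. f i) = (\<Sum>i\<in>I. 1 / (\<Prod>j\<in>I - {i}. f j))"
  unfolding sum_divide_distrib
proof (rule sum.cong[OF refl])
  fix i assume "i \<in> I"
  then show "f i / (\<Prod>j\<in>I. f j) = 1 / (\<Prod>j\<in>I - {i}. f j)"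
    using assms prod.remove[of I i f] by simp
qed

lemma finite_Qset:
  assumes "a > 0"
  shows "finite (Qset a b)"
  by (rule finite_subset[OF _ finite_divisors_nat[OF assms]]) (auto simp: Qset_def)

lemma SQ_MQ_enumeration:
  assumes "a > 0" "b dvd a"
  shows "\<exists>(s::nat) (x::nat \<Rightarrow> nat). s \<ge> 1 \<and> (\<forall>i\<in>{1..s}. x i > 0) \<and>
    SQ a b = (\<Sum>i=1..s. x i) \<and> MQ a b = (\<Prod>i=1..s. x i) \<and>
    real (SQ a b) / real (MQ a b) = (\<Sum>i=1..s. 1 / (\<Prod>j\<in>{1..s} - {i}. real (x j)))"
proof -
  define s where "s = card (Qset a b)"
  have "a \<in> Qset a b" using assms by (simp add: Qset_def lcm_proj1_if_dvd_nat)
  then have "s \<ge> 1"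
    unfolding s_def using finite_Qset[OF assms(1)]
    by (metis One_nat_def Suc_leI card_gt_0_iff empty_iff)
  obtain x where x: "bij_betw x {1..s} (Qset a b)"
    using ex_bij_betw_nat_finite_1[OF finite_Qset[OF assms(1)]] unfolding s_def by blast
  have pos: "x i > 0" if "i \<in> {1..s}" for i
    using bij_betw_apply[OF x that] by (simp add: Qset_def)
  have SQ: "SQ a b = (\<Sum>i=1..s. x i)" and MQ: "MQ a b = (\<Prod>i=1..s. x i)"
    using sum.reindex_bij_betw[OF x, of "\<lambda>x. x"] prod.reindex_bij_betw[OF x, of "\<lambda>x. x"]
    by (simp_all add: SQ_def MQ_def)
  have "real (SQ a b) / real (MQ a b) = (\<Sum>i=1..s. 1 / (\<Prod>j\<in>{1..s} - {i}. real (x j)))"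
    unfolding SQ MQ of_nat_sum of_nat_prod
    using pos by (intro sum_div_prod_eq_sum_inverse_others) (auto simp: Suc_le_eq)
  then show ?thesis using \<open>s \<ge> 1\<close> pos SQ MQ by blast
qed

theorem corollary9p6:
  shows
    "(\<forall>m::nat. m > 0 \<longrightarrow>
        (\<exists>n::nat. n > 0 \<and> gcd m n = 1 \<and> Q (m * n) (m * n) = Q (m * n) m * Q (m * n) n))
   \<and> (\<forall>m n::nat. prime m \<and> prime n \<and> m \<noteq> n \<longrightarrow>
        Q (m * n) (m * n) = Q (m * n) m + Q (m * n) n \<and>
        Q (m * n) m + Q (m * n) n = Q (m * n) m * Q (m * n) n)
   \<and> (\<forall>m n::nat. prime m \<and> n > 0 \<longrightarrow>
        (\<exists>t::nat. t > 0 \<and> gcd t m = 1 \<and>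
           (\<forall>k::nat. (k \<in> {0..<n} \<longrightarrow> Q (m ^ n) (m ^ k) = 1) \<and>
                     (k = n \<longrightarrow> Q (m ^ n) (m ^ k) = n + 1)) \<and>
           Q (t * m ^ n) (m ^ n) = n + 1))
   \<and> (\<forall>p k::nat. prime p \<and> k > 0 \<longrightarrow>
        ([k = 0] (mod p) \<longrightarrow> Q (p * k) p = 1) \<and>
        (\<not> [k = 0] (mod p) \<longrightarrow> Q (p * k) p = 2))
   \<and> (\<forall>a::nat. a > 0 \<longrightarrow>
        (\<exists>b::nat. b > 0 \<and> b dvd a \<and>
           (\<exists>(s::nat) (x::nat \<Rightarrow> nat). s \<ge> 1 \<and> (\<forall>i\<in>{1..s}. x i > 0) \<and>
              SQ a b = (\<Sum>i=1..s. x i) \<and>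
              MQ a b = (\<Prod>i=1..s. x i) \<and>
              real (SQ a b) / real (MQ a b) =
                (\<Sum>i=1..s. 1 / (\<Prod>j\<in>{1..s} - {i}. real (x j))))))"
proof (intro conjI allI impI)
  \<comment> \<open>All three values count divisors, the left one by the coprime case with cofactor \<open>1\<close>.\<close>
  have mult: "Q (m * n) (m * n) = Q (m * n) m * Q (m * n) n"
    if "m > 0" "n > 0" "coprime m n" for m n
    using that Q_coprime[of "m * n" 1] Q_coprime[of m n] Q_coprime[of n m]
    by (simp add: card_divisors_mult_coprime coprime_commute mult.commute)

  \<comment> \<open>The choice \<open>n = 1\<close> would make the identity trivial; the successor is a coprime partner
    of every \<open>m\<close> that does not.\<close>
  show "\<exists>n>0. gcd m n = 1 \<and> Q (m * n) (m * n) = Q (m * n) m * Q (m * n) n" if "m > 0" for m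
  proof (intro exI[of _ "Suc m"] conjI)
    have "coprime m (Suc m)" by simp
    then show "gcd m (Suc m) = 1" by (simp only: coprime_iff_gcd_eq_1)
    show "Q (m * Suc m) (m * Suc m) = Q (m * Suc m) m * Q (m * Suc m) (Suc m)"
      using that \<open>coprime m (Suc m)\<close> by (intro mult) simp_all
  qed simp

  fix m n :: nat
  assume mn: "prime m \<and> prime n \<and> m \<noteq> n"
  then have "coprime m n" by (simp add: primes_coprime)
  then have two: "Q (m * n) m = 2" "Q (m * n) n = 2"
    using Q_prime_power_coprime[of m n 1] Q_prime_power_coprime[of n m 1] mn
    by (simp_all add: coprime_commute mult.commute prime_gt_0_nat)
  show "Q (m * n) (m * n) = Q (m * n) m + Q (m * n) n"
    using mult[of m n] mn \<open>coprime m n\<close> two by (simp add: prime_gt_0_nat)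
  show "Q (m * n) m + Q (m * n) n = Q (m * n) m * Q (m * n) n"
    using two by simp
next
  fix m n :: nat
  assume "prime m \<and> n > 0"
  then show "\<exists>t>0. gcd t m = 1 \<and>
      (\<forall>k. (k \<in> {0..<n} \<longrightarrow> Q (m ^ n) (m ^ k) = 1) \<and> (k = n \<longrightarrow> Q (m ^ n) (m ^ k) = n + 1)) \<and>
      Q (t * m ^ n) (m ^ n) = n + 1"
    using Q_prime_power_less[of m _ n] Q_prime_power_coprime[of m 1 n]
    by (intro exI[of _ 1]) simp
next
  fix p k :: nat
  assume pk: "prime p \<and> k > 0"
  show "Q (p * k) p = 1" if "[k = 0] (mod p)"
  proof -
    have "p dvd k" using that by (simp add: cong_0_iff)
    then have "Q (k * p) p = 1"
      using pk by (intro Q_eq_1_if_prime_factors_dvd) (auto simp: prime_gt_0_nat intro: dvd_trans)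
    then show ?thesis by (simp add: mult.commute)
  qed
  show "Q (p * k) p = 2" if "\<not> [k = 0] (mod p)"
  proof -
    have "coprime k p"
      using that pk by (metis cong_0_iff coprime_commute prime_imp_coprime)
    then show ?thesis
      using Q_prime_power_coprime[of p k 1] pk by (simp add: mult.commute)
  qed
next
  \<comment> \<open>Any divisor of \<open>a\<close> is a possible \<open>b\<close>; the largest, \<open>b = a\<close>, makes the \<open>x i\<close> run
    through all divisors of \<open>a\<close>.\<close>
  fix a :: nat assume "a > 0"
  then show "\<exists>b>0. b dvd a \<and> (\<exists>(s::nat) (x::nat \<Rightarrow> nat). s \<ge> 1 \<and> (\<forall>i\<in>{1..s}. x i > 0) \<and>
      SQ a b = (\<Sum>i=1..s. x i) \<and> MQ a b = (\<Prod>i=1..s. x i) \<and>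
      real (SQ a b) / real (MQ a b) = (\<Sum>i=1..s. 1 / (\<Prod>j\<in>{1..s} - {i}. real (x j))))"
    by (intro exI[of _ a] conjI SQ_MQ_enumeration) simp_all
qed

end
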